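(* Let $n\ge 1$ and let $T\in \mathrm{GL}(n+1,\mathbb{R})$. Then the following statements hold. (i) There exist a conjugate $S$ of $T$ in $\mathrm{GL}(n+1,\mathbb{R})$ and $a\in\mathbb{R}^{n+1}\setminus\{0\}$ such that $\|S^{-1}(a)\|<1$ and the map $\overline{S}_a$ on $\mathbb{S}^n$ is not distal. (ii) There exist $a\in\mathbb{R}^{n+1}\setminus\{0\}$ and some $S\in\{T,T^2,T^3\}$ such that $\|S^{-1}(a)\|<1$ and the map $\overline{S}_a$ on $\mathbb{S}^n$ is not distal.
   Context: $\|\cdot\|$ is the Euclidean norm on $\mathbb{R}^{n+1}$ and $\mathbb{S}^n$ is its unit sphere. For $S\in\mathrm{GL}(n+1,\mathbb{R})$ and $a\in\mathbb{R}^{n+1}$, the map $\overline{S}_a\colon\mathbb{S}^n\to\mathbb{S}^n$ is defined by $\overline{S}_a(x)=\dfrac{a+S(x)}{\|a+S(x)\|}$; it is a homeomorphism whenever $\|S^{-1}(a)\|<1$. A homeomorphism $f$ of a metric space $X$ is distal if for every pair of distinct points $x,y\in X$ the closure of $\{(f^m(x),f^m(y)) : m\in\mathbb{Z}\}$ in $X\times X$ does not meet the diagonal $\{(c,c): c\in X\}$. *)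

theory Defs
  imports "HOL-Analysis.Analysis"
begin

definition int_iterate :: "'a set \<Rightarrow> ('a \<Rightarrow> 'a) \<Rightarrow> int \<Rightarrow> 'a \<Rightarrow> 'a" where
  "int_iterate X f m =
     (if 0 \<le> m then f ^^ nat m else inv_into X f ^^ nat (- m))"

text \<open>Only meaningful when \<open>f\<close> restricts to a homeomorphism of \<open>X\<close>; this is deliberately not
  part of the definition, so that the negation always yields a proximal pair. The ambient closure
  suffices: its points in \<open>X \<times> X\<close> form the closure in \<open>X \<times> X\<close>, which contains the diagonal of
  \<open>X\<close>.\<close>

definition distal_on :: "'a::metric_space set \<Rightarrow> ('a \<Rightarrow> 'a) \<Rightarrow> bool" where
  "distal_on X f \<longleftrightarrow>
     (\<forall>x\<in>X. \<forall>y\<in>X. x \<noteq> y \<longrightarrow>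
        closure {(int_iterate X f m x, int_iterate X f m y) | m. True} \<inter> {(c, c) | c. c \<in> X} = {})"

definition conjugate_GL :: "real^'d^'d \<Rightarrow> real^'d^'d \<Rightarrow> bool" where
  "conjugate_GL S T \<longleftrightarrow> (\<exists>P. invertible P \<and> S = P ** T ** matrix_inv P)"

definition sphere_map :: "real^'d^'d \<Rightarrow> real^'d \<Rightarrow> real^'d \<Rightarrow> real^'d" where
  "sphere_map S a x = (a + S *v x) /\<^sub>R norm (a + S *v x)"

lemma matrix_inv_right_left:
  fixes S :: "real^'d^'d"
  assumes "invertible S"
  shows "S ** matrix_inv S = mat 1" "matrix_inv S ** S = mat 1"
  using someI_ex[OF assms[unfolded invertible_def]] by (simp_all add: matrix_inv_def)

lemma sphere_map_nonzero:
  fixes S :: "real^'d^'d"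
  assumes S: "invertible S" and a: "norm (matrix_inv S *v a) < 1" and x: "norm x = 1"
  shows "a + S *v x \<noteq> 0"
proof
  assume "a + S *v x = 0"
  then have "matrix_inv S *v (a + S *v x) = 0" by simp
  then have "matrix_inv S *v a + x = 0"
    by (simp add: matrix_vector_right_distrib matrix_vector_mul_assoc matrix_inv_right_left[OF S])
  then have "norm (matrix_inv S *v a) = norm x"
    by (metis add_eq_0_iff norm_minus_cancel)
  then show False using a x by simp
qed

lemma sphere_map_homeomorphism:
  fixes S :: "real^'d^'d"
  assumes S: "invertible S" and a: "norm (matrix_inv S *v a) < 1"
  shows "homeomorphism (sphere 0 1) (sphere 0 1) (sphere_map S a)
           (inv_into (sphere 0 1) (sphere_map S a))"
proof -
  let ?X = "sphere 0 1 :: (real^'d) set" and ?f = "sphere_map S a"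
  define b where "b = matrix_inv S *v a"
  have b: "norm b < 1" using a by (simp add: b_def)
  have Sb: "S *v b = a"
    by (simp add: b_def matrix_vector_mul_assoc matrix_inv_right_left[OF S])
  have inv: "matrix_inv S *v (S *v x) = x" for x
    by (simp add: matrix_vector_mul_assoc matrix_inv_right_left[OF S])
  have inv': "S *v (matrix_inv S *v x) = x" for x
    by (simp add: matrix_vector_mul_assoc matrix_inv_right_left[OF S])
  have nz: "a + S *v x \<noteq> 0" if "x \<in> ?X" for x
    using sphere_map_nonzero[OF S a] that by simp
  have cont: "continuous_on ?X ?f"
    unfolding sphere_map_def
    by (intro continuous_intros matrix_vector_mult_linear_continuous_on) (use nz in auto)
  have inj: "inj_on ?f ?X"
  proof (rule inj_onI)
    fix x y assume x: "x \<in> ?X" and y: "y \<in> ?X" and eq: "?f x = ?f y"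
    define t where "t = norm (a + S *v x) / norm (a + S *v y)"
    have t: "t > 0" using nz[OF x] nz[OF y] by (simp add: t_def)
    have "a + S *v x = norm (a + S *v x) *\<^sub>R ?f x"
      using nz[OF x] by (simp add: sphere_map_def)
    also have "\<dots> = t *\<^sub>R (a + S *v y)"
      unfolding eq by (simp add: sphere_map_def t_def divide_inverse)
    finally have "S *v (b + x) = S *v (t *\<^sub>R (b + y))"
      by (simp add: matrix_vector_right_distrib matrix_vector_mult_scaleR Sb)
    then have e: "b + x = t *\<^sub>R (b + y)" by (metis inv)
    then have e': "x - t *\<^sub>R y = (t - 1) *\<^sub>R b" by (simp add: algebra_simps)
    have "\<bar>1 - t\<bar> = \<bar>norm x - norm (t *\<^sub>R y)\<bar>" using x y t by simp
    also have "\<dots> \<le> norm (x - t *\<^sub>R y)" by (rule norm_triangle_ineq3)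
    also have "\<dots> = \<bar>1 - t\<bar> * norm b" unfolding e' by (simp add: abs_minus_commute)
    finally have "\<bar>1 - t\<bar> * (1 - norm b) \<le> 0" by (simp add: algebra_simps)
    then have "t = 1" using b by (auto simp: mult_le_0_iff)
    then show "x = y" using e by simp
  qed
  have "?f ` ?X = ?X"
  proof
    show "?f ` ?X \<subseteq> ?X" using nz by (auto simp: sphere_map_def)
    show "?X \<subseteq> ?f ` ?X"
    proof
      fix z assume z: "z \<in> ?X"
      define w where "w = matrix_inv S *v z"
      have Sw: "S *v w = z" by (simp add: w_def inv')
      then have w: "norm w > 0" using z by auto
      define r where "r = 2 / norm w"
      have "2 \<le> norm (r *\<^sub>R w - b) + norm b"
        using norm_triangle_sub[of "r *\<^sub>R w" b] w by (simp add: r_def)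
      then have r: "1 \<le> norm (r *\<^sub>R w - b)" using b by simp
      have "\<exists>t\<ge>0. t \<le> r \<and> norm (t *\<^sub>R w - b) = 1"
        by (rule IVT') (use b r w in \<open>auto simp: r_def intro!: continuous_intros\<close>)
      then obtain t where t: "t \<ge> 0" "norm (t *\<^sub>R w - b) = 1" by auto
      have "t \<noteq> 0" using t b by auto
      have "a + S *v (t *\<^sub>R w - b) = t *\<^sub>R z"
        by (simp add: matrix_vector_mult_diff_distrib matrix_vector_mult_scaleR Sb Sw)
      then have "?f (t *\<^sub>R w - b) = z"
        using t \<open>t \<noteq> 0\<close> z by (simp add: sphere_map_def)
      then show "z \<in> ?f ` ?X" using t by force
    qed
  qed
  then obtain g where g: "homeomorphism ?X ?X ?f g"
    using homeomorphism_compact[OF compact_sphere cont _ inj] by blast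
  have "inv_into ?X ?f y = g y" if "y \<in> ?X" for y
    using g that inj unfolding homeomorphism_def
    by (metis image_eqI inv_into_f_f)
  then show ?thesis
    by (intro homeomorphism_cong[OF g]) auto
qed

end

theory Submission
  imports
    Defs
    "HOL-Computational_Algebra.Fundamental_Theorem_Algebra"
begin

text \<open>
  A repelling periodic point is an obstruction to distality: backward orbits that start near it
  converge to it, so they become proximal to the orbit of the point itself. The translation \<open>a\<close> is
  chosen so as to create such a point.

  Suppose that \<open>a + S p = s q\<close> with unit vectors \<open>p\<close>, \<open>q\<close> and \<open>s > 0\<close>, so that the sphere map takes
  \<open>p\<close> to \<open>q\<close>. Its derivative at \<open>p\<close> is \<open>S / s\<close> followed by the orthogonal projection along \<open>q\<close>,
  restricted to the tangent space of \<open>p\<close>. This is injective when \<open>S\<^sup>-\<^sup>1 q\<close> is not orthogonal to \<open>p\<close>,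
  and then the map expands by a factor of order \<open>1 / s\<close> near \<open>p\<close>; the inverse map has a local
  Lipschitz constant of order \<open>s\<close> near \<open>q\<close> (lemma \<open>inverse_locally_lipschitz\<close>). There are two ways
  to make \<open>s\<close> small along a whole periodic orbit.

  \<^item> If \<open>S x \<bullet> x > 0\<close> for some \<open>x\<close>, let \<open>p\<close> be the direction of \<open>S x\<close> and \<open>a = t p - S p\<close>. Then \<open>p\<close> is
    fixed, with \<open>s = t\<close>. Positivity of \<open>S\<^sup>-\<^sup>1 p \<bullet> p\<close> is exactly what gives
    \<open>norm (S\<^sup>-\<^sup>1 a) = norm (t S\<^sup>-\<^sup>1 p - p) < 1\<close> for small \<open>t > 0\<close>.
  \<^item> If \<open>S v = - \<mu> v\<close> with \<open>\<mu> > 0\<close> and \<open>norm v = 1\<close>, let \<open>a = (\<mu> - \<epsilon>) v\<close>. Then \<open>v\<close> and \<open>- v\<close> are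
    exchanged, with \<open>s = \<epsilon>\<close> and \<open>s = 2 \<mu> - \<epsilon>\<close>; the product of the two factors is small for small \<open>\<epsilon>\<close>.

  It remains to find a matrix of one of these two kinds. Among the conjugates of \<open>T\<close> this is easy:
  either a given vector is an eigenvector, or conjugation by a shear turns its image towards it.
  Among \<open>T\<close>, \<open>T\<^sup>2\<close>, \<open>T\<^sup>3\<close>, take a complex eigenvalue \<open>\<lambda>\<close> of \<open>T\<close>. The form \<open>S x \<bullet> x\<close> of \<open>S = T\<^sup>k\<close>, summed
  over the real and imaginary part of an eigenvector, has the sign of \<open>Re (\<lambda>\<^sup>k)\<close>. The real parts of
  \<open>\<lambda>\<close>, \<open>\<lambda>\<^sup>2\<close>, \<open>\<lambda>\<^sup>3\<close> are all nonpositive only for purely imaginary \<open>\<lambda>\<close>, and then \<open>T\<^sup>2\<close> has the negative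
  real eigenvalue \<open>\<lambda>\<^sup>2\<close>.
\<close>

section \<open>Complex eigenvalues of real matrices\<close>

text \<open>A root of the characteristic polynomial \<open>p\<close> exists unless \<open>p\<close> is constant. Constancy is excluded
  without computing degrees: \<open>r w = det (w A - I)\<close> is a polynomial with \<open>r 0 = det (- I) \<noteq> 0\<close>, whereas
  \<open>r w = w\<^sup>d p (1 / w)\<close> would tend to \<open>0\<close> at \<open>0\<close> if \<open>p\<close> were constant.\<close>

lemma complex_eigenvector_exists:
  fixes A :: "complex^'d^'d"
  obtains z v where "v \<noteq> 0" "A *v v = z *s v"
proof -
  let ?A = "\<lambda>i j. A $ i $ j"
  let ?I = "\<lambda>i j. (if i = j then 1 else 0) :: complex"
  define p where "p = det ((\<chi> i j. [:?A i j, - ?I i j:]) :: complex poly^'d^'d)"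
  define r where "r = det ((\<chi> i j. [:- ?I i j, ?A i j:]) :: complex poly^'d^'d)"
  have p: "poly p z = det ((\<chi> i j. ?A i j - z * ?I i j) :: complex^'d^'d)" for z
    by (simp add: p_def det_def poly_sum poly_prod)
  have r: "poly r w = det ((\<chi> i j. w * ?A i j - ?I i j) :: complex^'d^'d)" for w
    by (simp add: r_def det_def poly_sum poly_prod)
  have r_p: "poly r w = w ^ CARD('d) * poly p (1 / w)" if "w \<noteq> 0" for w
  proof -
    have "(\<chi> i j. w * ?A i j - ?I i j) = ((\<chi> i. w *s (\<chi> j. ?A i j - (1 / w) * ?I i j)) :: complex^'d^'d)"
      using that by (simp add: vec_eq_iff algebra_simps)
    then show ?thesis
      unfolding r p
      using det_rows_mul[of "\<lambda>_. w" "\<lambda>i. (\<chi> j. ?A i j - (1 / w) * ?I i j) :: complex^'d"]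
      by simp
  qed
  have "\<not> constant (poly p)"
  proof
    assume "constant (poly p)"
    then have c: "poly p z = poly p 0" for z
      by (auto simp: constant_def)
    have eq: "eventually (\<lambda>w. poly r w = w ^ CARD('d) * poly p 0) (at 0)"
      using r_p c by (simp add: eventually_at_filter)
    have "((\<lambda>w. w ^ CARD('d) * poly p 0) \<longlongrightarrow> 0 ^ CARD('d) * poly p 0) (at 0)"
      by (intro tendsto_intros)
    then have "((\<lambda>w. w ^ CARD('d) * poly p 0) \<longlongrightarrow> 0) (at 0)"
      by (simp add: zero_power)
    then have "(poly r \<longlongrightarrow> 0) (at 0)"
      by (simp add: filterlim_cong[OF refl refl eq])
    moreover have "(poly r \<longlongrightarrow> poly r 0) (at 0)"
      using poly_isCont[of 0 r] by (simp add: isCont_def)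
    ultimately have "poly r 0 = 0"
      using tendsto_unique[of "at 0"] trivial_limit_at by blast
    moreover have "poly r 0 = det ((\<chi> i. (- 1) *s (mat 1 :: complex^'d^'d) $ i) :: complex^'d^'d)"
      unfolding r by (rule arg_cong[of _ _ det]) (simp add: vec_eq_iff mat_def)
    then have "poly r 0 = (- 1) ^ CARD('d)"
      using det_rows_mul[of "\<lambda>_. - 1" "\<lambda>i. (mat 1 :: complex^'d^'d) $ i"] by simp
    ultimately show False by simp
  qed
  then obtain z where z: "poly p z = 0"
    using fundamental_theorem_of_algebra by blast
  define B where "B = ((\<chi> i j. ?A i j - z * ?I i j) :: complex^'d^'d)"
  have "\<not> invertible B"
    using z p[of z] by (simp add: B_def invertible_det_nz)
  then obtain v where v: "v \<noteq> 0" "B *v v = 0"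
    using matrix_left_invertible_ker[of B] by (auto simp: invertible_left_inverse)
  have B: "B $ i $ j * v $ j = ?A i j * v $ j - (if i = j then z * v $ j else 0)" for i j
    by (simp add: B_def left_diff_distrib)
  have "B *v v = A *v v - z *s v"
    by (simp add: vec_eq_iff matrix_vector_mult_def B sum_subtractf)
  then show thesis using that v by simp
qed

text \<open>The vectors \<open>u\<close> and \<open>w\<close> are the real and imaginary parts of a complex eigenvector for the
  eigenvalue \<open>\<alpha> + i \<beta>\<close>. They may be linearly dependent.\<close>

lemma real_eigenplane_exists:
  fixes T :: "real^'d^'d"
  obtains \<alpha> \<beta> u w where "u \<noteq> 0 \<or> w \<noteq> 0"
    "T *v u = \<alpha> *\<^sub>R u - \<beta> *\<^sub>R w" "T *v w = \<beta> *\<^sub>R u + \<alpha> *\<^sub>R w"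
proof -
  obtain z v where v: "v \<noteq> 0" "(\<chi> i j. complex_of_real (T $ i $ j)) *v v = z *s v"
    by (rule complex_eigenvector_exists)
  define u w where "u = (\<chi> i. Re (v $ i))" and "w = (\<chi> i. Im (v $ i))"
  have e: "(\<Sum>j\<in>UNIV. complex_of_real (T $ i $ j) * v $ j) = z * v $ i" for i
    using v(2) by (simp add: vec_eq_iff matrix_vector_mult_def)
  show thesis
  proof (rule that[of u w "Re z" "Im z"])
    show "u \<noteq> 0 \<or> w \<noteq> 0"
      using v(1) by (auto simp: u_def w_def vec_eq_iff complex_eq_iff)
    show "T *v u = Re z *\<^sub>R u - Im z *\<^sub>R w"
      using arg_cong[OF e, of Re] by (simp add: vec_eq_iff u_def w_def matrix_vector_mult_def)
    show "T *v w = Im z *\<^sub>R u + Re z *\<^sub>R w"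
      using arg_cong[OF e, of Im] 
      by (simp add: vec_eq_iff u_def w_def matrix_vector_mult_def algebra_simps)
  qed
qed

text \<open>If \<open>Re \<lambda>\<close>, \<open>Re (\<lambda>\<^sup>2)\<close> and \<open>Re (\<lambda>\<^sup>3)\<close> are all nonpositive then \<open>\<lambda>\<close> is purely imaginary: an
  argument strictly between \<open>\<pi> / 2\<close> and \<open>3 \<pi> / 2\<close> enters the open right half plane when it is doubled or
  tripled. So three powers suffice.\<close>

lemma power_with_positive_direction_or_negative_eigenvector:
  fixes T :: "real^'d^'d"
  assumes T: "invertible T"
  shows "(\<exists>S\<in>{T, T ** T, T ** T ** T}. \<exists>x. (S *v x) \<bullet> x > 0) \<or>
    (\<exists>v \<mu>. v \<noteq> 0 \<and> \<mu> > 0 \<and> (T ** T) *v v = - \<mu> *\<^sub>R v)"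
proof (rule disjCI)
  assume no: "\<not> (\<exists>v \<mu>. v \<noteq> 0 \<and> \<mu> > 0 \<and> (T ** T) *v v = - \<mu> *\<^sub>R v)"
  obtain \<alpha> \<beta> u w where nz: "u \<noteq> 0 \<or> w \<noteq> 0"
    and u: "T *v u = \<alpha> *\<^sub>R u - \<beta> *\<^sub>R w" and w: "T *v w = \<beta> *\<^sub>R u + \<alpha> *\<^sub>R w"
    by (rule real_eigenplane_exists)
  have N: "u \<bullet> u + w \<bullet> w > 0"
    using nz by (metis add_nonneg_pos add_pos_nonneg inner_ge_zero inner_gt_zero_iff)
  have pos: "\<exists>x. (S *v x) \<bullet> x > 0" if "(S *v u) \<bullet> u + (S *v w) \<bullet> w = c * (u \<bullet> u + w \<bullet> w)" "c > 0" for S c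
  proof (rule ccontr)
    assume "\<nexists>x. (S *v x) \<bullet> x > 0"
    then have "(S *v u) \<bullet> u \<le> 0" "(S *v w) \<bullet> w \<le> 0" by (auto simp: not_less)
    moreover have "c * (u \<bullet> u + w \<bullet> w) > 0" using N that by simp
    ultimately show False using that by linarith
  qed
  have lin: "S *v (a *\<^sub>R x + b *\<^sub>R y) = a *\<^sub>R (S *v x) + b *\<^sub>R (S *v y)"
            "S *v (a *\<^sub>R x - b *\<^sub>R y) = a *\<^sub>R (S *v x) - b *\<^sub>R (S *v y)" for S :: "real^'d^'d" and a b x y
    by (simp_all add: matrix_vector_right_distrib matrix_vector_mult_diff_distrib matrix_vector_mult_scaleR)
  have T2: "(T ** T) *v x = T *v (T *v x)" "(T ** T ** T) *v x = T *v (T *v (T *v x))" for x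
    by (simp_all add: matrix_vector_mul_assoc matrix_mul_assoc)
  \<comment> \<open>The coefficients on the right are the real parts of \<open>\<lambda>\<close>, \<open>\<lambda>\<^sup>2\<close>, \<open>\<lambda>\<^sup>3\<close> for \<open>\<lambda> = \<alpha> + i \<beta>\<close>.\<close>
  have 1: "(T *v u) \<bullet> u + (T *v w) \<bullet> w = \<alpha> * (u \<bullet> u + w \<bullet> w)"
    by (simp add: u w algebra_simps inner_commute)
  have 2: "((T ** T) *v u) \<bullet> u + ((T ** T) *v w) \<bullet> w = (\<alpha>\<^sup>2 - \<beta>\<^sup>2) * (u \<bullet> u + w \<bullet> w)"
    by (simp add: T2 u w lin inner_add_left inner_diff_left inner_commute[of w u] power2_eq_square
        left_diff_distrib right_diff_distrib distrib_left distrib_right)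
  have 3: "((T ** T ** T) *v u) \<bullet> u + ((T ** T ** T) *v w) \<bullet> w
      = (\<alpha> * (\<alpha>\<^sup>2 - 3 * \<beta>\<^sup>2)) * (u \<bullet> u + w \<bullet> w)"
    by (simp add: T2 u w lin inner_add_left inner_diff_left inner_commute[of w u] power2_eq_square
        left_diff_distrib right_diff_distrib distrib_left distrib_right)
  show "\<exists>S\<in>{T, T ** T, T ** T ** T}. \<exists>x. (S *v x) \<bullet> x > 0"
  proof (rule ccontr)
    assume "\<not> ?thesis"
    then have a: "\<alpha> \<le> 0" "\<alpha>\<^sup>2 - \<beta>\<^sup>2 \<le> 0" "\<alpha> * (\<alpha>\<^sup>2 - 3 * \<beta>\<^sup>2) \<le> 0"
      using pos[OF 1] pos[OF 2] pos[OF 3] by (auto simp: not_less[symmetric])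
    have "\<alpha> = 0"
    proof (rule ccontr)
      assume "\<alpha> \<noteq> 0"
      with a have "\<alpha>\<^sup>2 - 3 * \<beta>\<^sup>2 \<ge> 0" by (simp add: mult_le_0_iff)
      moreover have "\<alpha>\<^sup>2 > 0" using \<open>\<alpha> \<noteq> 0\<close> by simp
      ultimately show False using a(2) by linarith
    qed
    have "\<beta> \<noteq> 0"
    proof
      assume "\<beta> = 0"
      then have "T *v u = 0" "T *v w = 0" using u w \<open>\<alpha> = 0\<close> by auto
      then show False using nz T invertible_left_inverse matrix_left_invertible_ker by blast
    qed
    have "(T ** T) *v u = - (\<beta>\<^sup>2) *\<^sub>R u" "(T ** T) *v w = - (\<beta>\<^sup>2) *\<^sub>R w"
      using u w \<open>\<alpha> = 0\<close>
      by (simp_all add: T2 matrix_vector_mult_scaleR power2_eq_square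
          scaleR_right.minus flip: scaleR_minus_left)
    then show False using no nz \<open>\<beta> \<noteq> 0\<close> by (metis zero_less_power2)
  qed
qed

section \<open>Conjugation to a matrix with a positive direction\<close>

lemma conjugate_GL_refl: "conjugate_GL T T"
  unfolding conjugate_GL_def
  by (rule exI[of _ "mat 1"])
    (metis invertible_def matrix_inv_right_left(1) matrix_mul_lid matrix_mul_rid)

text \<open>Let \<open>w\<close> be the component of \<open>T x\<close> orthogonal to \<open>x\<close>. If \<open>w = 0\<close> then \<open>x\<close> is an eigenvector. Otherwise
  the shear \<open>P z = z + k (z \<bullet> w) x\<close> fixes \<open>x\<close> and pushes \<open>T x\<close> by an arbitrary amount along \<open>x\<close>, so that
  \<open>P T P\<^sup>-\<^sup>1 x \<bullet> x = P T x \<bullet> x\<close> can be given any value.\<close>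

lemma conjugate_with_positive_direction_or_negative_eigenvector:
  fixes T :: "real^'d^'d"
  assumes T: "invertible T"
  shows "(\<exists>S x. conjugate_GL S T \<and> (S *v x) \<bullet> x > 0) \<or>
    (\<exists>v \<mu>. v \<noteq> 0 \<and> \<mu> > 0 \<and> T *v v = - \<mu> *\<^sub>R v)"
proof -
  obtain x :: "real^'d" where x: "x \<noteq> 0"
    using zero_neq_one by metis
  define w where "w = T *v x - ((T *v x) \<bullet> x / (x \<bullet> x)) *\<^sub>R x"
  have wx: "w \<bullet> x = 0" using x by (simp add: w_def inner_diff_left)
  then have Tw: "(T *v x) \<bullet> w = w \<bullet> w"
    by (simp add: w_def inner_diff_left inner_diff_right inner_commute)
  show ?thesis
  proof (cases "w = 0")
    case True
    define \<nu> where "\<nu> = (T *v x) \<bullet> x / (x \<bullet> x)"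
    have e: "T *v x = \<nu> *\<^sub>R x" using True by (simp add: w_def \<nu>_def)
    have "\<nu> \<noteq> 0"
      using e x T invertible_left_inverse matrix_left_invertible_ker by force
    show ?thesis
    proof (cases "\<nu> > 0")
      case True
      then have "(T *v x) \<bullet> x > 0" using e x by simp
      then show ?thesis using conjugate_GL_refl by blast
    next
      case False
      then have "- \<nu> > 0" "T *v x = - (- \<nu>) *\<^sub>R x" using e \<open>\<nu> \<noteq> 0\<close> by auto
      then show ?thesis using x by blast
    qed
  next
    case False
    \<comment> \<open>This choice gives \<open>(P ** T ** matrix_inv P) *v x \<bullet> x = 1\<close>.\<close>
    define k where "k = (1 - (T *v x) \<bullet> x) / ((w \<bullet> w) * (x \<bullet> x))"
    define P where "P = matrix (\<lambda>z. z + (k * (z \<bullet> w)) *\<^sub>R x)"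
    have P: "P *v z = z + (k * (z \<bullet> w)) *\<^sub>R x" for z
      unfolding P_def
      by (rule fun_cong[OF matrix_vector_mul(2)]) (auto intro!: linearI simp: algebra_simps)
    have "\<forall>z. P *v z = 0 \<longrightarrow> z = 0"
    proof (intro allI impI)
      fix z assume z: "P *v z = 0"
      then have "(z + (k * (z \<bullet> w)) *\<^sub>R x) \<bullet> w = 0" by (simp add: P)
      then have "z \<bullet> w = 0" using wx by (simp add: inner_add_left inner_commute[of x w])
      then show "z = 0" using z by (simp add: P)
    qed
    then have inv: "invertible P"
      using invertible_left_inverse matrix_left_invertible_ker by blast
    have Px: "P *v x = x" using wx by (simp add: P inner_commute)
    then have "matrix_inv P *v x = x"
      by (metis inv matrix_inv_right_left(2) matrix_vector_mul_assoc matrix_vector_mul_lid)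
    then have "((P ** T ** matrix_inv P) *v x) \<bullet> x = (P *v (T *v x)) \<bullet> x"
      by (simp flip: matrix_vector_mul_assoc)
    also have "\<dots> = (T *v x) \<bullet> x + k * (w \<bullet> w) * (x \<bullet> x)"
      by (simp add: P Tw inner_add_left)
    also have "\<dots> = 1" using False x by (simp add: k_def)
    finally show ?thesis using inv unfolding conjugate_GL_def by (metis zero_less_one)
  qed
qed

section \<open>Local contraction by the inverse map\<close>

lemma sphere_map_cancel:
  fixes S :: "real^'d^'d"
  assumes "invertible S" "norm (matrix_inv S *v a) < 1" "norm x = 1"
  shows "a + S *v x = norm (a + S *v x) *\<^sub>R sphere_map S a x"
  using sphere_map_nonzero[OF assms] by (simp add: sphere_map_def)

lemma sphere_map_eqI:
  assumes "a + S *v x = s *\<^sub>R y" "s > 0" "norm y = 1"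
  shows "sphere_map S a x = y"
  using assms by (simp add: sphere_map_def)

lemma unit_difference_inner:
  fixes x p :: "'a::real_inner"
  assumes "norm x = 1" "norm p = 1"
  shows "(x - p) \<bullet> p = - (norm (x - p))\<^sup>2 / 2"
  using assms by (simp add: power2_norm_eq_inner inner_diff_left inner_diff_right inner_commute norm_eq_1)

text \<open>A quantitative form of the derivative being injective. Applying \<open>S\<^sup>-\<^sup>1\<close> to the difference of the two
  equations expresses \<open>x - p\<close> through \<open>y - q\<close> and the difference \<open>r - s\<close> of the lengths. The latter is
  controlled by taking the inner product with \<open>p\<close>, since \<open>(x - p) \<bullet> p\<close> is only quadratic in \<open>x - p\<close>
  and \<open>S\<^sup>-\<^sup>1 q \<bullet> p\<close> does not vanish. The last hypothesis lets half of \<open>norm (x - p)\<close> absorb the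
  quadratic term.\<close>

lemma expansion_estimate:
  fixes S :: "real^'d^'d"
  assumes S: "invertible S"
    and unit: "norm x = 1" "norm p = 1"
    and x: "a + S *v x = r *\<^sub>R y" and p: "a + S *v p = s *\<^sub>R q" and r: "r \<ge> 0"
    and M: "\<And>z. norm (matrix_inv S *v z) \<le> M * norm z" and q: "norm q = 1"
    and h: "h = \<bar>(matrix_inv S *v q) \<bullet> p\<bar>" "h > 0"
    and close: "M * norm (x - p) \<le> h"
  shows "norm (x - p) \<le> 2 * r * M * (1 + M / h) * norm (y - q)"
proof -
  define e where "e = x - p"
  define d where "d = norm (y - q)"
  let ?q = "matrix_inv S *v q" and ?d = "matrix_inv S *v (y - q)"
  have "S *v e = r *\<^sub>R (y - q) + (r - s) *\<^sub>R q"
    using arg_cong2[OF x p, of "(-)"] by (simp add: e_def matrix_vector_mult_diff_distrib algebra_simps)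
  then have "matrix_inv S *v (S *v e) = r *\<^sub>R ?d + (r - s) *\<^sub>R ?q"
    by (simp add: matrix_vector_right_distrib matrix_vector_mult_scaleR)
  then have e: "e = r *\<^sub>R ?d + (r - s) *\<^sub>R ?q"
    by (simp add: matrix_vector_mul_assoc matrix_inv_right_left[OF S])
  have d: "norm ?d \<le> M * d" and Mq: "norm ?q \<le> M"
    using M[of "y - q"] M[of q] q by (simp_all add: d_def)
  have M0: "M \<ge> 0" using Mq norm_ge_zero[of ?q] by linarith
  have "(r - s) * (?q \<bullet> p) = - (norm e)\<^sup>2 / 2 - r * (?d \<bullet> p)"
    using arg_cong[OF e, of "\<lambda>z. z \<bullet> p"] unit_difference_inner[OF unit]
    by (simp add: e_def inner_add_left)
  then have "\<bar>r - s\<bar> * h = \<bar>(norm e)\<^sup>2 / 2 + r * (?d \<bullet> p)\<bar>"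
    unfolding h(1) by (simp flip: abs_mult)
  also have "\<dots> \<le> (norm e)\<^sup>2 / 2 + r * (M * d)"
  proof -
    have "\<bar>?d \<bullet> p\<bar> \<le> M * d"
      using Cauchy_Schwarz_ineq2[of ?d p] d unit by simp
    then have "\<bar>r * (?d \<bullet> p)\<bar> \<le> r * (M * d)"
      using r by (simp add: abs_mult mult_left_mono)
    then show ?thesis
      using abs_triangle_ineq[of "(norm e)\<^sup>2 / 2" "r * (?d \<bullet> p)"] by simp
  qed
  finally have rs: "\<bar>r - s\<bar> \<le> ((norm e)\<^sup>2 / 2 + r * (M * d)) / h"
    using h(2) by (simp add: pos_le_divide_eq)
  have "norm e \<le> r * norm ?d + \<bar>r - s\<bar> * norm ?q"
    using norm_triangle_ineq[of "r *\<^sub>R ?d" "(r - s) *\<^sub>R ?q"] r e by simp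
  also have "\<dots> \<le> r * (M * d) + ((norm e)\<^sup>2 / 2 + r * (M * d)) / h * M"
    using mult_left_mono[OF d r] mult_mono[OF rs Mq] rs by force
  also have "\<dots> = (M * norm e) / h * (norm e / 2) + r * M * (1 + M / h) * d"
    using h(2) by (simp add: field_simps power2_eq_square)
  also have "\<dots> \<le> 1 * (norm e / 2) + r * M * (1 + M / h) * d"
    using close h(2) by (intro add_right_mono mult_right_mono) (simp_all add: e_def)
  finally show ?thesis by (simp add: e_def d_def)
qed

abbreviation sphere_map_inverse :: "real^'d^'d \<Rightarrow> real^'d \<Rightarrow> real^'d \<Rightarrow> real^'d" where
  "sphere_map_inverse S a \<equiv> inv_into (sphere 0 1) (sphere_map S a)"

text \<open>The point is the factor \<open>s\<close>: everything else in the constant depends on \<open>S\<close>, \<open>p\<close> and \<open>q\<close> only, not on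
  the translation \<open>a\<close>. Continuity of the inverse map brings \<open>x = sphere_map_inverse S a y\<close> close
  enough to \<open>p\<close> for the expansion estimate, and for \<open>norm (a + S *v x) \<le> 2 * s\<close>.\<close>

lemma inverse_locally_lipschitz:
  fixes S :: "real^'d^'d"
  assumes S: "invertible S" and a: "norm (matrix_inv S *v a) < 1"
    and p: "norm p = 1" "a + S *v p = s *\<^sub>R q" and s: "s > 0" and q: "norm q = 1"
    and M: "M > 0" "\<And>z. norm (matrix_inv S *v z) \<le> M * norm z"
    and h: "h = \<bar>(matrix_inv S *v q) \<bullet> p\<bar>" "h > 0"
  shows "\<exists>\<delta>>0. \<forall>y\<in>sphere 0 1. dist y q < \<delta> \<longrightarrow>
    dist (sphere_map_inverse S a y) p \<le> 4 * s * M * (1 + M / h) * dist y q"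
proof -
  let ?f = "sphere_map S a" and ?g = "sphere_map_inverse S a"
  have hom: "homeomorphism (sphere 0 1) (sphere 0 1) ?f ?g"
    by (rule sphere_map_homeomorphism[OF S a])
  have gq: "?g q = p"
    using homeomorphism_apply1[OF hom, of p] sphere_map_eqI[OF p(2) s q] p(1) by simp
  have "continuous_on (sphere 0 1) (\<lambda>x. norm (a + S *v x))"
    by (intro continuous_intros matrix_vector_mult_linear_continuous_on)
  moreover have "norm (a + S *v p) = s" using p s q by simp
  ultimately obtain \<epsilon> where \<epsilon>: "\<epsilon> > 0"
    "\<And>x. norm x = 1 \<Longrightarrow> dist x p < \<epsilon> \<Longrightarrow> dist (norm (a + S *v x)) s < s"
    using s p(1) unfolding continuous_on_iff by (metis dist_0_norm mem_sphere)
  define \<eta> where "\<eta> = min \<epsilon> (h / M)"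
  have "\<eta> > 0" using \<epsilon> h M by (simp add: \<eta>_def)
  moreover have "continuous_on (sphere 0 1) ?g" 
    using hom by (simp add: homeomorphism_def)
  ultimately obtain \<delta> where \<delta>: "\<delta> > 0"
    "\<And>y. norm y = 1 \<Longrightarrow> dist y q < \<delta> \<Longrightarrow> dist (?g y) (?g q) < \<eta>"
    using q unfolding continuous_on_iff by (metis dist_0_norm mem_sphere)
  have "dist (?g y) p \<le> 4 * s * M * (1 + M / h) * dist y q"
    if y: "norm y = 1" "dist y q < \<delta>" for y
  proof -
    define x where "x = ?g y"
    have x: "norm x = 1" "?f x = y"
      using hom y(1) homeomorphism_image2[OF hom] homeomorphism_apply2[OF hom, of y] 
      by (auto simp: x_def)
    have near: "dist x p < \<eta>" using \<delta>(2)[OF y] by (simp add: gq x_def)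
    define r where "r = norm (a + S *v x)"
    have r: "0 \<le> r" "r \<le> 2 * s"
      using \<epsilon>(2)[OF x(1)] near by (auto simp: r_def \<eta>_def dist_real_def)
    have "a + S *v x = r *\<^sub>R y"
      using sphere_map_cancel[OF S a x(1)] x(2) by (simp add: r_def)
    moreover have "M * norm (x - p) \<le> h"
      using near M(1) by (simp add: \<eta>_def dist_norm pos_less_divide_eq mult.commute)
    ultimately have "norm (x - p) \<le> 2 * r * M * (1 + M / h) * norm (y - q)"
      using expansion_estimate[OF S x(1) p(1) _ p(2) r(1) M(2) q h] by blast
    also have "\<dots> \<le> 2 * (2 * s) * M * (1 + M / h) * norm (y - q)"
      using r M h(2) by (intro mult_right_mono mult_left_mono) auto
    finally show ?thesis by (simp add: x_def dist_norm)
  qed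
  then show ?thesis using \<delta>(1) by auto
qed

section \<open>Repelling periodic points destroy distality\<close>

text \<open>The case \<open>p = q\<close> is a fixed point, \<open>p \<noteq> q\<close> an orbit of period two; in both cases the second iterate
  of the inverse is a contraction towards \<open>p\<close> near \<open>p\<close>. Any nearby point of \<open>X\<close> other than \<open>p\<close> is then
  proximal to \<open>p\<close>, and being a limit point provides one.\<close>

lemma not_distal_on_if_inverse_contracts:
  fixes f :: "'a::metric_space \<Rightarrow> 'a"
  assumes hom: "homeomorphism X X f (inv_into X f)" and p: "p islimpt X" "p \<in> X" and qX: "q \<in> X"
    and pq: "inv_into X f q = p" "inv_into X f p = q"
    and near_q: "\<exists>\<delta>>0. \<forall>y\<in>X. dist y q < \<delta> \<longrightarrow> dist (inv_into X f y) p \<le> K1 * dist y q"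
    and near_p: "\<exists>\<delta>>0. \<forall>y\<in>X. dist y p < \<delta> \<longrightarrow> dist (inv_into X f y) q \<le> K2 * dist y p"
    and K: "0 \<le> K1" "0 \<le> K2" "K1 * K2 < 1"
  shows "\<not> distal_on X f"
proof -
  define g where "g = inv_into X f"
  define G where "G = (\<lambda>y. g (g y))"
  obtain \<delta>1 \<delta>2 where \<delta>: "\<delta>1 > 0" "\<delta>2 > 0"
    "\<And>y. y \<in> X \<Longrightarrow> dist y q < \<delta>1 \<Longrightarrow> dist (g y) p \<le> K1 * dist y q"
    "\<And>y. y \<in> X \<Longrightarrow> dist y p < \<delta>2 \<Longrightarrow> dist (g y) q \<le> K2 * dist y p"
    using near_q near_p unfolding g_def by blast
  have gX: "g y \<in> X" if "y \<in> X" for y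
    using hom that homeomorphism_image2[OF hom] by (auto simp: g_def)
  \<comment> \<open>The second bound keeps the image under \<open>g\<close> within \<open>\<delta>1\<close> of \<open>q\<close>; adding \<open>1\<close> allows \<open>K2 = 0\<close>.\<close>
  define \<delta> where "\<delta> = min \<delta>2 (\<delta>1 / (K2 + 1))"
  have "\<delta> > 0" using \<delta> K by (simp add: \<delta>_def)
  have G: "dist (G y) p \<le> K1 * K2 * dist y p" if y: "y \<in> X" "dist y p < \<delta>" for y
  proof -
    have g: "dist (g y) q \<le> K2 * dist y p" using y \<delta>(4) by (simp add: \<delta>_def)
    also have "\<dots> \<le> (K2 + 1) * dist y p" by (simp add: mult_right_mono)
    also have "\<dots> < \<delta>1" using y(2) K by (simp add: \<delta>_def pos_less_divide_eq mult.commute)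
    finally have "dist (G y) p \<le> K1 * dist (g y) q"
      using \<delta>(3)[OF gX[OF y(1)]] by (simp add: G_def)
    also have "\<dots> \<le> K1 * (K2 * dist y p)" using g K(1) by (rule mult_left_mono)
    finally show ?thesis by (simp add: mult.assoc)
  qed
  obtain y where y: "y \<in> X" "y \<noteq> p" "dist y p < \<delta>"
    using p(1) \<open>\<delta> > 0\<close> unfolding islimpt_approachable by blast
  have Gm: "(G ^^ m) y \<in> X \<and> dist ((G ^^ m) y) p \<le> (K1 * K2) ^ m * dist y p" for m
  proof (induction m)
    case (Suc m)
    let ?z = "(G ^^ m) y"
    have "(K1 * K2) ^ m * dist y p \<le> 1 * dist y p"
      using K by (intro mult_right_mono power_le_one) auto
    then have "dist (G ?z) p \<le> K1 * K2 * dist ?z p"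
      using Suc y by (intro G) linarith+
    also have "\<dots> \<le> K1 * K2 * ((K1 * K2) ^ m * dist y p)"
      using Suc K by (intro mult_left_mono) auto
    finally show ?case using Suc gX by (simp add: G_def mult.assoc)
  qed (use y in auto)
  have "(\<lambda>m. (K1 * K2) ^ m * dist y p) \<longlonglongrightarrow> 0"
    using K by (intro tendsto_mult_left_zero LIMSEQ_realpow_zero) auto
  then have "(\<lambda>m. dist ((G ^^ m) y) p) \<longlonglongrightarrow> 0"
    by (rule Lim_null_comparison[rotated]) (use Gm in simp)
  then have "(\<lambda>m. (G ^^ m) y) \<longlonglongrightarrow> p" by (rule tendsto_dist_iff[THEN iffD2])
  moreover have iter: "int_iterate X f (- int (2 * m)) z = (G ^^ m) z" for m z
  proof -
    have "(g ^^ (2 * m)) z = (G ^^ m) z"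
      by (induction m) (simp_all add: G_def)
    moreover have "nat (2 * int m) = 2 * m" by simp
    ultimately show ?thesis by (cases "m = 0") (simp_all add: int_iterate_def g_def)
  qed
  moreover have "(G ^^ m) p = p" for m
    by (induction m) (simp_all add: G_def g_def pq)
  ultimately have "(\<lambda>m. (int_iterate X f (- int (2 * m)) y, int_iterate X f (- int (2 * m)) p)) \<longlonglongrightarrow> (p, p)"
    by (auto intro!: tendsto_Pair)
  then have "(p, p) \<in> closure {(int_iterate X f m y, int_iterate X f m p) | m. True}"
    by (intro closure_sequential[THEN iffD2] exI conjI allI) auto
  then show ?thesis using y(1,2) p(2) unfolding distal_on_def by blast
qed

lemma sphere_point_islimpt:
  fixes p :: "'a::euclidean_space"
  assumes "2 \<le> DIM('a)" "norm p = 1"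
  shows "p islimpt sphere 0 1"
proof (rule connected_imp_perfect)
  show "connected (sphere 0 1 :: 'a set)" by (rule connected_sphere[OF assms(1)])
  fix x :: 'a
  have "p \<in> sphere 0 1" "- p \<in> sphere 0 1" "p \<noteq> - p"
    using assms(2) scaleR_left_distrib[of 1 1 p] by (auto simp: eq_neg_iff_add_eq_0)
  then show "sphere 0 1 \<noteq> {x}" by (metis singletonD)
qed (use assms in simp)

lemma not_distal_if_orbit_expands:
  fixes S :: "real^'d^'d"
  assumes dim: "2 \<le> CARD('d)"
    and S: "invertible S" and a: "norm (matrix_inv S *v a) < 1"
    and pq: "norm p = 1" "norm q = 1" "a + S *v p = s *\<^sub>R q" "a + S *v q = t *\<^sub>R p" "s > 0" "t > 0"
    and h: "\<bar>(matrix_inv S *v q) \<bullet> p\<bar> = h" "\<bar>(matrix_inv S *v p) \<bullet> q\<bar> = h" "h > 0"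
    and M: "M > 0" "\<And>z. norm (matrix_inv S *v z) \<le> M * norm z"
    and st: "(4 * M * (1 + M / h))\<^sup>2 * (s * t) < 1"
  shows "\<not> distal_on (sphere 0 1) (sphere_map S a)"
proof -
  let ?C = "4 * M * (1 + M / h)"
  note hom = sphere_map_homeomorphism[OF S a]
  have inv: "sphere_map_inverse S a q = p" "sphere_map_inverse S a p = q"
    using homeomorphism_apply1[OF hom, of p] homeomorphism_apply1[OF hom, of q]
      sphere_map_eqI[OF pq(3,5,2)] sphere_map_eqI[OF pq(4,6,1)] pq(1,2) by simp_all
  show ?thesis
  proof (rule not_distal_on_if_inverse_contracts[OF hom, of p q "4 * s * M * (1 + M / h)" "4 * t * M * (1 + M / h)"])
    show "p islimpt sphere 0 1"
      by (rule sphere_point_islimpt) (use dim pq in simp_all)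
    have "4 * s * M * (1 + M / h) * (4 * t * M * (1 + M / h)) = ?C\<^sup>2 * (s * t)"
      by (simp only: power2_eq_square ac_simps)
    then show "4 * s * M * (1 + M / h) * (4 * t * M * (1 + M / h)) < 1" using st by (simp only:)
    show "\<exists>\<delta>>0. \<forall>y\<in>sphere 0 1. dist y q < \<delta> \<longrightarrow>
        dist (sphere_map_inverse S a y) p \<le> 4 * s * M * (1 + M / h) * dist y q"
      by (rule inverse_locally_lipschitz[OF S a pq(1,3,5,2) M h(1)[symmetric] h(3)])
    show "\<exists>\<delta>>0. \<forall>y\<in>sphere 0 1. dist y p < \<delta> \<longrightarrow>
        dist (sphere_map_inverse S a y) q \<le> 4 * t * M * (1 + M / h) * dist y p"
      by (rule inverse_locally_lipschitz[OF S a pq(2,4,6,1) M h(2)[symmetric] h(3)])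
  qed (use pq(1,2,5,6) inv M(1) h(3) in simp_all)
qed

section \<open>Translations that create a repelling orbit\<close>

lemma small_factor_exists:
  fixes C m :: real
  assumes "m > 0"
  obtains t where "0 < t" "t < m" "C * t < 1"
proof -
  define t where "t = min (m / 2) (1 / (2 * (\<bar>C\<bar> + 1)))"
  have t: "0 < t" "t < m" using assms by (auto simp: t_def)
  have "C * t \<le> \<bar>C\<bar> * (1 / (2 * (\<bar>C\<bar> + 1)))"
    using t(1) by (intro mult_mono) (auto simp: t_def)
  also have "\<dots> < 1" by (simp add: divide_less_eq)
  finally show thesis using that t by blast
qed

lemma matrix_inv_bound_exists:
  fixes S :: "real^'d^'d"
  obtains M where "M > 0" "\<And>z. norm (matrix_inv S *v z) \<le> M * norm z"
proof -
  obtain M where "M > 0" "\<forall>z. norm (matrix_inv S *v z) \<le> norm z * M"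
    using bounded_linear.pos_bounded[OF matrix_vector_mul_bounded_linear, of "matrix_inv S"] by blast
  then show thesis using that[of M] by (metis mult.commute)
qed

text \<open>The bound \<open>t < 2 h / (b \<bullet> b)\<close> on \<open>t\<close> amounts to \<open>norm (t b - p) < 1\<close>, where \<open>b = S\<^sup>-\<^sup>1 p\<close> and
  \<open>h = b \<bullet> p\<close>; the bound by \<open>norm (S p)\<close> keeps \<open>a\<close> away from zero, and \<open>C t < 1\<close> makes the fixed point
  \<open>p\<close> repelling.\<close>

lemma not_distal_translation_if_positive_direction:
  fixes S :: "real^'d^'d"
  assumes dim: "2 \<le> CARD('d)" and S: "invertible S" and x: "(S *v x) \<bullet> x > 0"
  obtains a where "a \<noteq> 0" "norm (matrix_inv S *v a) < 1"
    "\<not> distal_on (sphere 0 1) (sphere_map S a)"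
proof -
  have inv: "matrix_inv S *v (S *v z) = z" for z
    by (simp add: matrix_vector_mul_assoc matrix_inv_right_left[OF S])
  have Sx: "S *v x \<noteq> 0" using x by auto
  define p where "p = S *v x /\<^sub>R norm (S *v x)"
  define b where "b = matrix_inv S *v p"
  have p: "norm p = 1" using Sx by (simp add: p_def)
  have b: "b = x /\<^sub>R norm (S *v x)" by (simp add: b_def p_def matrix_vector_mult_scaleR inv)
  define h where "h = b \<bullet> p"
  have h: "h > 0" using x Sx by (simp add: h_def b p_def inner_commute)
  have "b \<noteq> 0" using h by (auto simp: h_def)
  have "S *v p \<noteq> 0" using p inv[of p] by auto
  obtain M where M: "M > 0" "\<And>z. norm (matrix_inv S *v z) \<le> M * norm z"
    using matrix_inv_bound_exists[of S] by metis
  define C where "C = 4 * M * (1 + M / h)"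
  obtain t where t: "0 < t" "t < min (norm (S *v p)) (2 * h / (b \<bullet> b))" "C * t < 1"
    using small_factor_exists[of "min (norm (S *v p)) (2 * h / (b \<bullet> b))" C] h \<open>b \<noteq> 0\<close> \<open>S *v p \<noteq> 0\<close>
    by auto
  define a where "a = t *\<^sub>R p - S *v p"
  show thesis
  proof (rule that)
    show "a \<noteq> 0"
    proof
      assume "a = 0"
      then have "norm (S *v p) = norm (t *\<^sub>R p)" by (simp add: a_def)
      then show False using t p by simp
    qed
    have a: "matrix_inv S *v a = t *\<^sub>R b - p"
      by (simp add: a_def b_def matrix_vector_mult_diff_distrib matrix_vector_mult_scaleR inv)
    have "(norm (matrix_inv S *v a))\<^sup>2 = t * (t * (b \<bullet> b)) - 2 * t * h + 1"
      using p by (simp add: a power2_norm_eq_inner inner_diff_left inner_diff_right h_def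
          inner_commute norm_eq_1 algebra_simps)
    also have "\<dots> < t * (2 * h) - 2 * t * h + 1"
      using t \<open>b \<noteq> 0\<close> by (simp add: pos_less_divide_eq)
    finally have "(norm (matrix_inv S *v a))\<^sup>2 < 1\<^sup>2" by simp
    then show norm_a: "norm (matrix_inv S *v a) < 1" by (rule power2_less_imp_less) simp
    have "C > 0" using M(1) h by (simp add: C_def add_pos_pos)
    then have "(C * t)\<^sup>2 < 1" using t by (simp add: power_less_one_iff)
    then have st: "C\<^sup>2 * (t * t) < 1" by (simp add: power2_eq_square ac_simps)
    show "\<not> distal_on (sphere 0 1) (sphere_map S a)"
      by (rule not_distal_if_orbit_expands[OF dim S norm_a p p _ _ t(1) t(1) _ _ h M st[unfolded C_def]])
        (use h in \<open>simp_all add: a_def h_def b_def\<close>)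
  qed
qed

text \<open>Translating by almost \<open>\<mu> v\<close> shrinks \<open>a + S v\<close> to length \<open>\<epsilon>\<close>, so the step from \<open>v\<close> to \<open>- v\<close> expands
  strongly, while the step back has the bounded length \<open>2 \<mu> - \<epsilon>\<close> and contracts at most by a bounded
  factor.\<close>

lemma not_distal_translation_if_negative_eigenvector:
  fixes S :: "real^'d^'d"
  assumes dim: "2 \<le> CARD('d)" and S: "invertible S"
    and x: "x \<noteq> 0" "S *v x = - \<mu> *\<^sub>R x" and \<mu>: "\<mu> > 0"
  obtains a where "a \<noteq> 0" "norm (matrix_inv S *v a) < 1"
    "\<not> distal_on (sphere 0 1) (sphere_map S a)"
proof -
  define v where "v = x /\<^sub>R norm x"
  have v: "norm v = 1" and Sv: "S *v v = - \<mu> *\<^sub>R v"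
    using x by (simp_all add: v_def matrix_vector_mult_scaleR)
  have "matrix_inv S *v (S *v v) = v"
    by (simp add: matrix_vector_mul_assoc matrix_inv_right_left[OF S])
  then have "v = - \<mu> *\<^sub>R (matrix_inv S *v v)"
    by (simp only: Sv matrix_vector_mult_scaleR)
  then have "- (1 / \<mu>) *\<^sub>R v = - (1 / \<mu>) *\<^sub>R (- \<mu> *\<^sub>R (matrix_inv S *v v))"
    by (rule arg_cong)
  then have inv: "matrix_inv S *v v = - (1 / \<mu>) *\<^sub>R v"
    using \<mu> by simp
  obtain M where M: "M > 0" "\<And>z. norm (matrix_inv S *v z) \<le> M * norm z"
    using matrix_inv_bound_exists[of S] by metis
  define h where "h = 1 / \<mu>"
  have h: "h > 0" using \<mu> by (simp add: h_def)
  define C where "C = 4 * M * (1 + M / h)"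
  obtain \<epsilon> where \<epsilon>: "0 < \<epsilon>" "\<epsilon> < \<mu>" "C\<^sup>2 * (2 * \<mu>) * \<epsilon> < 1"
    using small_factor_exists[OF \<mu>] by metis
  define a where "a = (\<mu> - \<epsilon>) *\<^sub>R v"
  show thesis
  proof (rule that)
    show "a \<noteq> 0" using v \<epsilon> by (auto simp: a_def)
    have "matrix_inv S *v a = - (((\<mu> - \<epsilon>) / \<mu>) *\<^sub>R v)"
      by (simp add: a_def matrix_vector_mult_scaleR inv)
    then show norm_a: "norm (matrix_inv S *v a) < 1"
      using v \<epsilon> \<mu> by (simp add: abs_of_pos)
    have "C\<^sup>2 * (\<epsilon> * (2 * \<mu> - \<epsilon>)) \<le> C\<^sup>2 * (\<epsilon> * (2 * \<mu>))"
      using \<epsilon> by (intro mult_left_mono) auto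
    then have st: "C\<^sup>2 * (\<epsilon> * (2 * \<mu> - \<epsilon>)) < 1" using \<epsilon>(3) by (simp add: ac_simps)
    have orbit: "a + S *v v = \<epsilon> *\<^sub>R (- v)" "a + S *v (- v) = (2 * \<mu> - \<epsilon>) *\<^sub>R v"
      by (simp add: a_def Sv scaleR_left_diff_distrib)
        (simp add: a_def Sv vec.neg flip: scaleR_left_distrib)
    show "\<not> distal_on (sphere 0 1) (sphere_map S a)"
      by (rule not_distal_if_orbit_expands[OF dim S norm_a v _ orbit _ _ _ _ h M st[unfolded C_def]])
        (use v \<epsilon> \<mu> in \<open>simp_all add: inv vec.neg h_def norm_eq_1\<close>)
  qed
qed

section \<open>Non-distal conjugates and powers\<close>

theorem corollary13:
  fixes n :: nat and T :: "real^'d^'d"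
  assumes "n \<ge> 1" and "CARD('d) = n + 1" and "invertible T"
  shows "(\<exists>S a. conjugate_GL S T \<and> a \<noteq> 0 \<and> norm (matrix_inv S *v a) < 1 \<and>
            \<not> distal_on (sphere 0 1) (sphere_map S a)) \<and>
         (\<exists>a. a \<noteq> 0 \<and> (\<exists>S\<in>{T, T ** T, T ** T ** T}. norm (matrix_inv S *v a) < 1 \<and>
            \<not> distal_on (sphere 0 1) (sphere_map S a)))"
proof
  have dim: "2 \<le> CARD('d)" using assms by simp
  note T = \<open>invertible T\<close>
  have conj: "invertible S" if "conjugate_GL S T" for S
    using that T matrix_inv_right_left unfolding conjugate_GL_def
    by (metis invertible_mult invertible_def)
  show "\<exists>S a. conjugate_GL S T \<and> a \<noteq> 0 \<and> norm (matrix_inv S *v a) < 1 \<and>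
      \<not> distal_on (sphere 0 1) (sphere_map S a)"
    using conjugate_with_positive_direction_or_negative_eigenvector[OF T]
  proof (elim disjE exE conjE)
    fix S x assume S: "conjugate_GL S T" "(S *v x) \<bullet> x > 0"
    show ?thesis
      using not_distal_translation_if_positive_direction[OF dim conj[OF S(1)] S(2)] S(1) by metis
  next
    fix v \<mu> assume "v \<noteq> 0" "0 < \<mu>" "T *v v = - \<mu> *\<^sub>R v"
    then show ?thesis
      using not_distal_translation_if_negative_eigenvector[OF dim T] conjugate_GL_refl by metis
  qed
  have inv: "invertible S" if "S \<in> {T, T ** T, T ** T ** T}" for S
    using that T invertible_mult by blast
  show "\<exists>a. a \<noteq> 0 \<and> (\<exists>S\<in>{T, T ** T, T ** T ** T}. norm (matrix_inv S *v a) < 1 \<and>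
      \<not> distal_on (sphere 0 1) (sphere_map S a))"
    using power_with_positive_direction_or_negative_eigenvector[OF T]
  proof (elim disjE exE bexE conjE)
    fix S x assume S: "S \<in> {T, T ** T, T ** T ** T}" "(S *v x) \<bullet> x > 0"
    show ?thesis
      using not_distal_translation_if_positive_direction[OF dim inv[OF S(1)] S(2)] S(1) by metis
  next
    fix v \<mu> assume v: "v \<noteq> 0" "0 < \<mu>" "(T ** T) *v v = - \<mu> *\<^sub>R v"
    have "invertible (T ** T)" by (rule inv) simp
    from not_distal_translation_if_negative_eigenvector[OF dim this v(1,3,2)]
    show ?thesis by (metis insertI1 insertI2)
  qed
qed

end
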